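(* Let $\alpha > 0$ and $u > 0$ be real constants, and let $r_t = \lceil u t \rceil$ for every integer $t \ge 1$. Then there is no sequence of nonnegative real numbers $(\alpha_t)_{t \ge 1}$ with $\sum_{t=1}^{\infty} \alpha_t = \alpha$ such that the $p$-value requirements $\delta_t = \alpha_t r_t$ are equal for all $t \in \{1, 2, \ldots\}$.
   Context: Setting: in an unbounded sequential test with decision points $t = 1, 2, 3, \ldots$, a Type I error budget $\alpha$ is split into nonnegative amounts $\alpha_t$ with $\sum_{t=1}^{\infty} \alpha_t = \alpha$. The number of significant decision points among $1, \ldots, t$ required to stop and reject the null hypothesis at decision point $t$ is $r_t$. The $p$-value requirement for significance at decision point $t$ is $\delta_t = \alpha_t r_t$, i.e. the $p$-value $p_t$ at decision point $t$ counts as significant when $p_t \le \delta_t$. *)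

theory Defs
  imports Complex_Main
begin

text \<open>
  Decision points are the natural numbers \<open>t \<ge> 1\<close>; sequences have type \<open>nat \<Rightarrow> _\<close> and their
  value at \<open>0\<close> carries no meaning, hence the shift by \<open>Suc\<close> in the series.
\<close>

definition error_spending :: "real \<Rightarrow> (nat \<Rightarrow> real) \<Rightarrow> bool" where
  "error_spending \<alpha> a \<longleftrightarrow> (\<forall>t\<ge>1. 0 \<le> a t) \<and> (\<lambda>k. a (Suc k)) sums \<alpha>"

text \<open>
  With \<open>a t\<close> the error budget and \<open>r t\<close> the number of significant decision points required
  for stopping at \<open>t\<close>, the p-value at \<open>t\<close> is significant iff it is at most this bound.
\<close>

definition p_value_requirement :: "(nat \<Rightarrow> real) \<Rightarrow> (nat \<Rightarrow> int) \<Rightarrow> nat \<Rightarrow> real" where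
  "p_value_requirement a r t = a t * of_int (r t)"

end

(* If all requirements equal c, then a t = c / r t, and r t grows at most linearly.  So the budget
   series vanishes when c = 0 and dominates a multiple of the harmonic series when c > 0. *)
theory Submission
  imports Defs "HOL-Analysis.Summation_Tests"
begin

text \<open>Let c be the common requirement. For t \<ge> 1, \<open>r t\<close> lies between 1 and (u
  + 1) t, so c > 0 forces \<open>a t\<close> \<ge> c / ((u + 1) t), and convergence of the budget
  contradicts \<open>not_summable_harmonic\<close>. If c = 0, every \<open>a t\<close> vanishes and
  the total cannot be \<alpha> > 0.\<close>

theorem theorem3:
  fixes \<alpha> u :: real and r :: "nat \<Rightarrow> int"
  assumes "\<alpha> > 0" and "u > 0"
    and "\<And>t. t \<ge> 1 \<Longrightarrow> r t = \<lceil>u * real t\<rceil>"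
  shows "\<not> (\<exists>a :: nat \<Rightarrow> real. error_spending \<alpha> a \<and>
    (\<forall>s\<ge>1. \<forall>t\<ge>1. p_value_requirement a r s = p_value_requirement a r t))"
proof
  assume "\<exists>a :: nat \<Rightarrow> real. error_spending \<alpha> a \<and>
    (\<forall>s\<ge>1. \<forall>t\<ge>1. p_value_requirement a r s = p_value_requirement a r t)"
  then obtain a :: "nat \<Rightarrow> real" where nonneg: "\<And>t. t \<ge> 1 \<Longrightarrow> 0 \<le> a t"
    and sums: "(\<lambda>k. a (Suc k)) sums \<alpha>"
    and eq: "\<And>s t. s \<ge> 1 \<Longrightarrow> t \<ge> 1 \<Longrightarrow> a s * of_int (r s) = a t * of_int (r t)"
    unfolding error_spending_def p_value_requirement_def by blast
  define c where "c = a 1 * of_int (r 1)"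
  have c: "a (Suc k) * of_int (r (Suc k)) = c" for k
    unfolding c_def by (rule eq) auto
  have r_pos: "0 < r (Suc k)" for k
    using assms(2,3) by simp
  have r_le: "of_int (r (Suc k)) \<le> (u + 1) * real (Suc k)" for k
  proof -
    have "of_int (r (Suc k)) \<le> u * real (Suc k) + 1"
      using assms(3)[of "Suc k"] of_int_ceiling_le_add_one[of "u * real (Suc k)"] by simp
    \<comment> \<open>The rounding error 1 is absorbed because 1 \<le>
      \<open>real (Suc k)\<close>.\<close>
    then show ?thesis by (simp add: algebra_simps)
  qed
  show False
  proof (cases "c = 0")
    case True
    then have "a (Suc k) = 0" for k
      using c[of k] r_pos[of k] by simp
    then have "\<alpha> = 0"
      using sums by (simp add: sums_0 sums_unique2)
    then show False using assms(1) by simp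
  next
    case False
    have "0 \<le> c"
      using nonneg[of 1] r_pos[of 0] by (simp add: c_def)
    have "summable (\<lambda>k. inverse (real (Suc k)))"
    proof (rule summable_comparison_test')
      \<comment> \<open>The factor comes from solving c \<le> \<open>a (Suc k)\<close> (u + 1) (k +
        1) for 1 / (k + 1).\<close>
      show "summable (\<lambda>k. (u + 1) / c * a (Suc k))"
        using sums by (intro summable_mult) (rule sums_summable)
      fix k :: nat
      have "c \<le> a (Suc k) * ((u + 1) * real (Suc k))"
        using mult_left_mono[OF r_le[of k] nonneg[of "Suc k"]] by (simp add: c)
      then show "norm (inverse (real (Suc k))) \<le> (u + 1) / c * a (Suc k)"
        using False \<open>0 \<le> c\<close> by (simp add: field_simps)
    qed
    then show False
      \<comment> \<open>The library's harmonic series starts at index 0; the shift does not affect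
        summability.\<close>
      using not_summable_harmonic[where 'a = real] summable_Suc_iff[of "\<lambda>k. inverse (real k)"]
      by (simp add: inverse_eq_divide)
  qed
qed

end
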